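(* Let $n\ge1$, $L>0$, $\epsilon\ge0$ and $0<\mu_i\le L$ for $i=1,\dots,n$. Put $\overline\mu=\frac1n\sum_{i=1}^n\mu_i$, $\alpha=\prod_{i=1}^n\big(1-\frac{\mu_i}{L}\big)$ and $$\overline M=\mathbb{E}_\xi\Big[\sum_{k=0}^{n-1}\prod_{s=k+1}^{n-1}\Big(1-\frac{\mu_{\xi(s)}}{L}\Big)\Big],$$ where $(\xi(0),\dots,\xi(n-1))$ is a uniformly random permutation of $\{1,\dots,n\}$ and an empty product equals $1$. Then $$\alpha\le\Big(1-\frac{\overline\mu}{L}\Big)^n\qquad\text{and}\qquad \frac{2\epsilon\overline M}{L(1-\alpha)}\le\frac{2\epsilon}{\overline\mu}.$$
   Context: Here $\alpha$ and $\frac{2\epsilon\overline M}{L(1-\alpha)}$ are the per-epoch contraction factor and the asymptotic error in the bound for SGD with random reshuffle on a sum of $n$ losses (smoothness constant $L$, weak strong convexity constants $\mu_i$, minimizer incoherence bound $\epsilon$), while $(1-\overline\mu/L)^n$ and $2\epsilon/\overline\mu$ are the corresponding quantities for SGD with random (with-replacement) sampling. The claim is purely about these numbers. *)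

theory Defs
  imports "HOL-Probability.Probability" "HOL-Combinatorics.Multiset_Permutations"
begin

definition mu_bar :: "nat \<Rightarrow> (nat \<Rightarrow> real) \<Rightarrow> real" where
  "mu_bar n \<mu> = (1 / real n) * (\<Sum>i=1..n. \<mu> i)"

definition epoch_contraction :: "nat \<Rightarrow> real \<Rightarrow> (nat \<Rightarrow> real) \<Rightarrow> real" where
  "epoch_contraction n L \<mu> = (\<Prod>i=1..n. 1 - \<mu> i / L)"

(* A permutation is the list [xi(0), ..., xi(n-1)] of its values, so xi ! s is xi(s). *)
definition M_bar :: "nat \<Rightarrow> real \<Rightarrow> (nat \<Rightarrow> real) \<Rightarrow> real" where
  "M_bar n L \<mu> =
     measure_pmf.expectation (pmf_of_set (permutations_of_set {1..n}))
       (\<lambda>\<xi>. \<Sum>k = 0..<n. \<Prod>s = k+1..<n. (1 - \<mu> (\<xi> ! s) / L))"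

end

theory Submission
  imports Defs
begin

text \<open>
  Put \<open>a i = 1 - \<mu> i / L\<close>, so that \<open>0 \<le> a i < 1\<close>, and let \<open>c\<close> be the average of the \<open>a i\<close>, so that
  \<open>1 - c\<close> is the averaged \<open>\<mu>\<close> divided by \<open>L\<close>.  Let \<open>w k\<close> be the mean, over a uniformly random
  ordering \<open>\<xi>\<close>, of the product of the \<open>a (\<xi> ! s)\<close> with \<open>k \<le> s < n\<close>; up to indexing these are the
  normalised elementary symmetric means of the \<open>a i\<close>.  Both claims are about this one sequence:
  \<open>w n = 1\<close>, \<open>w 0\<close> is the epoch contraction, and \<open>M_bar\<close> is \<open>w 1 + \<dots> + w n\<close>.

  Everything follows from \<open>w k \<le> c * w (k + 1)\<close>: sampling without replacement is negatively
  correlated, so multiplying by a fresh entry yields at most what an independent sample, whose mean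
  is \<open>c\<close>, would yield (\<open>mean_prod_insert_le\<close>).  Iterating the inequality gives \<open>w 0 \<le> c ^ n\<close>.
  Rewritten as \<open>(1 - c) * w (k + 1) \<le> w (k + 1) - w k\<close> and summed over \<open>k\<close>, it telescopes to
  \<open>(1 - c) * M_bar \<le> 1 - w 0\<close>, which is the second claim after clearing denominators.

  The negative correlation comes from exchangeability.  An independent sample can be drawn from a
  uniformly random position \<open>t\<close> of the same ordering.  If the position is not already used in the
  product, it is as good as a fresh one; if it is used, a square \<open>x\<^sup>2\<close> appears in place of a product
  \<open>x * y\<close> of two exchangeable entries, and \<open>2 * x * y \<le> x\<^sup>2 + y\<^sup>2\<close>.
\<close>

definition mean_prod :: "'a set \<Rightarrow> ('a \<Rightarrow> real) \<Rightarrow> nat set \<Rightarrow> real" where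
  "mean_prod A a J = (\<Sum>\<xi>\<in>permutations_of_set A. \<Prod>s\<in>J. a (\<xi> ! s)) / fact (card A)"

text \<open>Exchangeability: interchanging two entries is an involution on the orderings.\<close>

lemma sum_permutations_of_set_swap:
  fixes f :: "'a list \<Rightarrow> real"
  assumes "t < card A" "u < card A"
  shows "(\<Sum>\<xi>\<in>permutations_of_set A. f (\<xi>[t := \<xi> ! u, u := \<xi> ! t]))
           = (\<Sum>\<xi>\<in>permutations_of_set A. f \<xi>)"
proof -
  let ?swap = "\<lambda>\<xi>. \<xi>[t := \<xi> ! u, u := \<xi> ! t]"
  have len: "t < length \<xi>" "u < length \<xi>" if "\<xi> \<in> permutations_of_set A" for \<xi>
    using length_finite_permutations_of_set[OF that] assms by simp_all
  have inv: "?swap (?swap \<xi>) = \<xi>" if "\<xi> \<in> permutations_of_set A" for \<xi>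
    using len[OF that] by (auto intro!: nth_equalityI simp: nth_list_update)
  have closed: "?swap \<xi> \<in> permutations_of_set A" if "\<xi> \<in> permutations_of_set A" for \<xi>
    using len[OF that] that by (simp add: permutations_of_set_def)
  show ?thesis
    by (rule sum.reindex_bij_witness[where i = ?swap and j = ?swap]) (simp_all add: inv closed)
qed

lemma bij_betw_nth_permutation:
  assumes "\<xi> \<in> permutations_of_set A"
  shows "bij_betw (\<lambda>t. \<xi> ! t) {..<card A} A"
  using permutations_of_setD[OF assms] length_finite_permutations_of_set[OF assms]
  by (intro bij_betw_nth) auto

lemma nth_in_permutation:
  assumes "\<xi> \<in> permutations_of_set A" "s < card A"
  shows "\<xi> ! s \<in> A"
  using bij_betwE[OF bij_betw_nth_permutation[OF assms(1)]] assms(2) by blast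

lemma sum_nth_permutation:
  fixes a :: "'a \<Rightarrow> real"
  assumes "\<xi> \<in> permutations_of_set A"
  shows "(\<Sum>t<card A. a (\<xi> ! t)) = sum a A"
  using bij_betw_nth_permutation[OF assms] by (rule sum.reindex_bij_betw)

lemma prod_nth_permutation:
  fixes a :: "'a \<Rightarrow> real"
  assumes "\<xi> \<in> permutations_of_set A"
  shows "(\<Prod>t<card A. a (\<xi> ! t)) = prod a A"
  using bij_betw_nth_permutation[OF assms] by (rule prod.reindex_bij_betw)

lemma mean_prod_empty: "finite A \<Longrightarrow> mean_prod A a {} = 1"
  by (simp add: mean_prod_def)

lemma mean_prod_full: "finite A \<Longrightarrow> mean_prod A a {..<card A} = prod a A"
  by (simp add: mean_prod_def prod_nth_permutation)

text \<open>
  For \<open>t \<notin> J\<close> the two sides agree by exchangeability of \<open>t\<close> and \<open>u\<close>; for \<open>t \<in> J\<close> the right side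
  contains the square of the entry at \<open>t\<close>.  Because the left side does not depend on \<open>t\<close>, the
  inequality can be summed over all positions, where the entries \<open>a (\<xi> ! t)\<close> add up to a total
  that no longer depends on \<open>\<xi>\<close>.
\<close>

lemma sum_fresh_entry_le:
  fixes a :: "'a \<Rightarrow> real"
  assumes nonneg: "\<And>i. i \<in> A \<Longrightarrow> 0 \<le> a i"
    and J: "J \<subseteq> {..<card A}" and u: "u < card A" "u \<notin> J" and t: "t < card A"
  shows "(\<Sum>\<xi>\<in>permutations_of_set A. \<Prod>s\<in>insert u J. a (\<xi> ! s))
           \<le> (\<Sum>\<xi>\<in>permutations_of_set A. a (\<xi> ! t) * (\<Prod>s\<in>J. a (\<xi> ! s)))"
proof -
  let ?P = "permutations_of_set A"
  have fin: "finite J" using J finite_subset by blast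
  have len: "length \<xi> = card A" if "\<xi> \<in> ?P" for \<xi>
    using that by (rule length_finite_permutations_of_set)
  have swap_nth: "\<xi>[t := \<xi> ! u, u := \<xi> ! t] ! t = \<xi> ! u" if "\<xi> \<in> ?P" for \<xi>
    using t u len[OF that] by (simp add: nth_list_update)
  have swap_prod: "(\<Prod>s\<in>I. a (\<xi>[t := \<xi> ! u, u := \<xi> ! t] ! s)) = (\<Prod>s\<in>I. a (\<xi> ! s))"
    if "I \<subseteq> J" "t \<notin> I" for I \<xi>
  proof (rule prod.cong[OF refl])
    fix s assume "s \<in> I"
    then have "s \<noteq> t" "s \<noteq> u" using that u by auto
    then show "a (\<xi>[t := \<xi> ! u, u := \<xi> ! t] ! s) = a (\<xi> ! s)" by simp
  qed
  show ?thesis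
  proof (cases "t \<in> J")
    case False
    have "(\<Sum>\<xi>\<in>?P. a (\<xi> ! t) * (\<Prod>s\<in>J. a (\<xi> ! s)))
        = (\<Sum>\<xi>\<in>?P. a (\<xi> ! u) * (\<Prod>s\<in>J. a (\<xi> ! s)))"
      using False t u
      by (subst sum_permutations_of_set_swap[OF t u(1), symmetric])
        (auto intro!: sum.cong simp: swap_prod swap_nth)
    then show ?thesis using u fin by simp
  next
    case True
    define Q where "Q = (\<lambda>\<xi>. \<Prod>s\<in>J - {t}. a (\<xi> ! s))"
    have J_split: "(\<Prod>s\<in>J. a (\<xi> ! s)) = a (\<xi> ! t) * Q \<xi>" for \<xi>
      unfolding Q_def using True fin by (rule prod.remove[rotated])
    have Q_nonneg: "0 \<le> Q \<xi>" if "\<xi> \<in> ?P" for \<xi>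
      unfolding Q_def using J that by (intro prod_nonneg) (auto intro!: nonneg nth_in_permutation)
    have squares: "(\<Sum>\<xi>\<in>?P. (a (\<xi> ! t))\<^sup>2 * Q \<xi>) = (\<Sum>\<xi>\<in>?P. (a (\<xi> ! u))\<^sup>2 * Q \<xi>)"
      using t u
      by (subst sum_permutations_of_set_swap[OF t u(1), symmetric])
        (auto intro!: sum.cong simp: Q_def swap_prod swap_nth)
    have "2 * (\<Sum>\<xi>\<in>?P. a (\<xi> ! u) * (a (\<xi> ! t) * Q \<xi>))
        = (\<Sum>\<xi>\<in>?P. (2 * a (\<xi> ! t) * a (\<xi> ! u)) * Q \<xi>)"
      by (simp add: sum_distrib_left mult_ac)
    also have "\<dots> \<le> (\<Sum>\<xi>\<in>?P. ((a (\<xi> ! t))\<^sup>2 + (a (\<xi> ! u))\<^sup>2) * Q \<xi>)"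
      by (intro sum_mono mult_right_mono Q_nonneg sum_squares_bound)
    also have "\<dots> = 2 * (\<Sum>\<xi>\<in>?P. (a (\<xi> ! t))\<^sup>2 * Q \<xi>)"
      using squares by (simp add: distrib_right sum.distrib)
    finally show ?thesis
      using u fin by (simp add: J_split power2_eq_square mult.assoc)
  qed
qed

lemma mean_prod_insert_le:
  fixes a :: "'a \<Rightarrow> real"
  assumes nonneg: "\<And>i. i \<in> A \<Longrightarrow> 0 \<le> a i"
    and J: "J \<subseteq> {..<card A}" and u: "u < card A" "u \<notin> J"
  shows "mean_prod A a (insert u J) \<le> sum a A / card A * mean_prod A a J"
proof -
  let ?P = "permutations_of_set A"
  have "card A * (\<Sum>\<xi>\<in>?P. \<Prod>s\<in>insert u J. a (\<xi> ! s))
      = (\<Sum>t<card A. \<Sum>\<xi>\<in>?P. \<Prod>s\<in>insert u J. a (\<xi> ! s))"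
    by simp
  also have "\<dots> \<le> (\<Sum>t<card A. \<Sum>\<xi>\<in>?P. a (\<xi> ! t) * (\<Prod>s\<in>J. a (\<xi> ! s)))"
    by (intro sum_mono sum_fresh_entry_le assms) auto
  also have "\<dots> = (\<Sum>\<xi>\<in>?P. (\<Sum>t<card A. a (\<xi> ! t)) * (\<Prod>s\<in>J. a (\<xi> ! s)))"
    by (subst sum.swap) (simp add: sum_distrib_right)
  also have "\<dots> = sum a A * (\<Sum>\<xi>\<in>?P. \<Prod>s\<in>J. a (\<xi> ! s))"
    by (simp add: sum_nth_permutation sum_distrib_left)
  finally show ?thesis
    using u(1) by (simp add: mean_prod_def field_simps)
qed

theorem mainTheorem4:
  fixes n :: nat and L \<epsilon> :: real and \<mu> :: "nat \<Rightarrow> real"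
  assumes "n \<ge> 1"
    and "L > 0"
    and "\<epsilon> \<ge> 0"
    and "\<And>i. i \<in> {1..n} \<Longrightarrow> 0 < \<mu> i \<and> \<mu> i \<le> L"
  shows "epoch_contraction n L \<mu> \<le> (1 - mu_bar n \<mu> / L) ^ n \<and>
         2 * \<epsilon> * M_bar n L \<mu> / (L * (1 - epoch_contraction n L \<mu>)) \<le> 2 * \<epsilon> / mu_bar n \<mu>"
proof -
  define a where "a = (\<lambda>i. 1 - \<mu> i / L)"
  define c where "c = sum a {1..n} / n"
  define w where "w = (\<lambda>k. mean_prod {1..n} a {k..<n})"
  define \<alpha> where "\<alpha> = epoch_contraction n L \<mu>"
  have a_nonneg: "0 \<le> a i" if "i \<in> {1..n}" for i
    using assms(2) assms(4)[OF that] by (simp add: a_def)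
  have c_eq: "c = 1 - mu_bar n \<mu> / L"
    using assms(1) by (simp add: c_def a_def mu_bar_def sum_subtractf sum_divide_distrib[symmetric]
      diff_divide_distrib)
  have mu_pos: "0 < mu_bar n \<mu>"
    unfolding mu_bar_def using assms(1,4) by (intro mult_pos_pos sum_pos) auto
  have c_nonneg: "0 \<le> c"
    unfolding c_def using a_nonneg by (intro divide_nonneg_nonneg sum_nonneg) auto
  have c_less: "c < 1"
    using mu_pos assms(2) by (simp add: c_eq)

  have w_n: "w n = 1"
    by (simp add: w_def mean_prod_empty)
  have w_0: "w 0 = \<alpha>"
    using mean_prod_full[of "{1..n}" a]
    by (simp add: w_def \<alpha>_def epoch_contraction_def a_def atLeast0LessThan)
  have w_step: "w k \<le> c * w (Suc k)" if "k < n" for k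
  proof -
    have "{k..<n} = insert k {Suc k..<n}" using that by auto
    moreover have "{Suc k..<n} \<subseteq> {..<card {1..n}}" by auto
    ultimately show ?thesis
      using mean_prod_insert_le[of "{1..n}" a "{Suc k..<n}" k, OF a_nonneg] that
      by (simp add: w_def c_def)
  qed

  have "w (n - j) \<le> c ^ j" if "j \<le> n" for j
    using that
  proof (induction j)
    case 0
    then show ?case by (simp add: w_n)
  next
    case (Suc j)
    have "w (n - Suc j) \<le> c * w (n - j)"
      using w_step[of "n - Suc j"] Suc.prems by (simp add: Suc_diff_Suc)
    also have "\<dots> \<le> c * c ^ j"
      using Suc c_nonneg by (intro mult_left_mono) auto
    finally show ?case by simp
  qed
  from this[of n] have contraction: "\<alpha> \<le> c ^ n"
    by (simp add: w_0)
  have "c ^ n < 1"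
    using c_nonneg c_less assms(1) by (simp add: power_less_one_iff)
  with contraction have \<alpha>_less: "\<alpha> < 1" by simp

  have M_eq: "M_bar n L \<mu> = (\<Sum>k<n. w (Suc k))"
  proof -
    have "M_bar n L \<mu>
        = (\<Sum>\<xi>\<in>permutations_of_set {1..n}. \<Sum>k<n. \<Prod>s = Suc k..<n. a (\<xi> ! s)) / fact n"
      unfolding M_bar_def by (subst integral_pmf_of_set) (simp_all add: a_def atLeast0LessThan)
    also have "\<dots> = (\<Sum>k<n. w (Suc k))"
      by (subst sum.swap) (simp add: w_def mean_prod_def sum_divide_distrib)
    finally show ?thesis .
  qed
  have "(1 - c) * M_bar n L \<mu> = (\<Sum>k<n. w (Suc k) - c * w (Suc k))"
    by (simp add: M_eq sum_distrib_left left_diff_distrib)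
  also have "\<dots> \<le> (\<Sum>k<n. w (Suc k) - w k)"
    by (intro sum_mono) (simp add: w_step)
  also have "\<dots> = 1 - \<alpha>"
    by (simp add: sum_lessThan_telescope w_n w_0)
  finally have key: "mu_bar n \<mu> * M_bar n L \<mu> \<le> L * (1 - \<alpha>)"
    using assms(2) by (simp add: c_eq field_simps)
  have "2 * \<epsilon> * (mu_bar n \<mu> * M_bar n L \<mu>) \<le> 2 * \<epsilon> * (L * (1 - \<alpha>))"
    using key assms(3) by (intro mult_left_mono) auto
  moreover have "0 < L * (1 - \<alpha>)"
    using \<alpha>_less assms(2) by simp
  ultimately have "2 * \<epsilon> * M_bar n L \<mu> / (L * (1 - \<alpha>)) \<le> 2 * \<epsilon> / mu_bar n \<mu>"
    using mu_pos by (simp add: divide_le_eq le_divide_eq mult_ac)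
  with contraction show ?thesis
    by (simp add: \<alpha>_def c_eq)
qed

end
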